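(* Fix $1\le m\le\infty$ and let $\mathbf{J}^{(m)}=[J^{(m)}_{n,k}(\boldsymbol\beta)]_{n,k\ge0}$ be the $m$-Jacobi--Rogers triangle, with production matrix $P^{(m)}(\boldsymbol\beta)$. Let $a,b,u,v,\lambda,\widehat a_i,\widehat b_i,\widehat c_i$ ($i\ge1$) be indeterminates, $\mathbf x$ a set of indeterminates, and $r\ge1$. Assume that (for a suitable choice of the weights $\boldsymbol\beta$) $P^{(m)}(\boldsymbol\beta)$ equals a finite product, in some order, of the matrix $\mathbf{J}(a,b,u,v,\lambda)$ and matrices each of which is of the form $\mathbf{L}(\widehat a_i,\widehat b_i,\widehat c_i)$ or $\boldsymbol\Gamma^{(\Lambda,f_i(t))}$ ($i\ge1$), where each $f_i(t)$ is an $\mathbf x$-Pólya frequency function of order $r$. Then: (i) the binomial row-generating matrix $\mathbf{J}^{(m)}(q)$ is coefficientwise totally positive of order $r$ in $(a,b,u,v,\lambda,\widehat{\mathbf a},\widehat{\mathbf b},\widehat{\mathbf c},\mathbf x,q)$; (ii) the sequence $(\mathbf{J}_n(q))_{n\ge0}$ of row-generating polynomials $\mathbf J_n(q)=\sum_k J^{(m)}_{n,k}(\boldsymbol\beta)q^k$ is coefficientwise Hankel-totally positive of order $r$ in $(a,b,u,v,\lambda,\widehat{\mathbf a},\widehat{\mathbf b},\widehat{\mathbf c},\mathbf x,q)$.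
   Context: A partial $m$-Łukasiewicz path is a lattice path in $\mathbb Z\times\mathbb N$ starting on the horizontal axis, using steps $(1,s)$ with $-m\le s\le1$ (rise $s=1$, level step $s=0$, $\ell$-fall $s=-\ell$). For weights $\boldsymbol\beta=(\beta^{(\ell)}_i)_{-1\le\ell\le m,\ i\ge\ell}$, $J^{(m)}_{n,k}(\boldsymbol\beta)$ is the generating polynomial of partial $m$-Łukasiewicz paths from $(0,0)$ to $(n,k)$ where each rise at height $i$ has weight $\beta^{(-1)}_i$ if $m=1$ and weight $1$ if $m>1$, each level step at height $i$ has weight $\beta^{(0)}_i$, and each $\ell$-fall from height $i$ has weight $\beta^{(\ell)}_i$. The matrix $P^{(m)}(\boldsymbol\beta)$ has entries $P_{i,i+1}=\beta^{(-1)}_i$ if $m=1$ and $=1$ if $m>1$, $P_{ij}=\beta^{(i-j)}_i$ for $i-m\le j\le i$, and $0$ otherwise. $\mathbf L(a,b,c)$ is the lower-bidiagonal matrix with diagonal entries $ka+b$ ($k\ge0$) and subdiagonal entries $(k,k-1)$ equal to $kc$ ($k\ge1$). $\mathbf J(a,b,u,v,\lambda)$ is the tridiagonal matrix with entries $(n,n+1)$ equal to $r_n=un+u+v$, $(n,n)$ equal to $s_n=(2\lambda u+a)n+b+\lambda(u+v)$, $(n,n-1)$ equal to $t_n=\lambda(a+\lambda u)n$. For a power series $f(t)=\sum_{n\ge0}f_nt^n$, $\Gamma(f)=[f_{i-j}]_{i,j\ge0}$ is its Toeplitz matrix, $\Lambda=\mathrm{diag}(0!,1!,2!,\ldots)$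 and $\boldsymbol\Gamma^{(\Lambda,f)}=\Lambda\Gamma(f)\Lambda^{-1}$, i.e. entries $\frac{i!}{j!}f_{i-j}$. $f(t)$ is an $\mathbf x$-Pólya frequency function of order $r$ if $f_n\in\mathbb R[\mathbf x]$ and $\Gamma(f)$ is coefficientwise totally positive of order $r$ in $\mathbf x$. For a matrix $M$, $\mathbf B_q=[\binom nk q^{n-k}]_{n,k}$ and the binomial row-generating matrix is $M(q)=M\mathbf B_q$ (its zeroth column consists of the row-generating polynomials). A matrix over $\mathbb R[\mathbf z]$ is coefficientwise totally positive of order $r$ in $\mathbf z$ if all minors of size $\le r$ are polynomials with nonnegative coefficients; a sequence is coefficientwise Hankel-totally positive of order $r$ if its Hankel matrix $[a_{i+j}]$ is. *)

theory Defs
  imports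
    "HOL-Library.Poly_Mapping"
    "HOL-Library.Extended_Nat"
    "HOL-Computational_Algebra.Formal_Power_Series"
    "Jordan_Normal_Form.Determinant"
begin

text \<open>Polynomials with real coefficients in a set of commuting indeterminates: finitely supported
  functions from monomials (finitely supported exponent vectors) to the reals.\<close>

type_synonym 'z mpol = "('z \<Rightarrow>\<^sub>0 nat) \<Rightarrow>\<^sub>0 real"

definition Var :: "'z \<Rightarrow> 'z mpol" where
  "Var z = Poly_Mapping.single (Poly_Mapping.single z 1) 1"

definition Const :: "real \<Rightarrow> 'z mpol" where
  "Const c = Poly_Mapping.single 0 c"

definition indets :: "'z mpol \<Rightarrow> 'z set" where
  "indets p = (\<Union>mon \<in> Poly_Mapping.keys p. Poly_Mapping.keys mon)"

definition cw_nonneg :: "'z mpol \<Rightarrow> bool" where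
  "cw_nonneg p \<longleftrightarrow> (\<forall>mon. 0 \<le> Poly_Mapping.lookup p mon)"

type_synonym 'a imat = "nat \<Rightarrow> nat \<Rightarrow> 'a"

text \<open>The constant \<^const>\<open>Sum_any\<close> sums over the finitely many indices with nonzero summand,
  which is the product of infinite matrices whenever the left factor is row-finite.\<close>

definition imult :: "'a::comm_ring_1 imat \<Rightarrow> 'a imat \<Rightarrow> 'a imat" where
  "imult A B = (\<lambda>i j. Sum_any (\<lambda>k. A i k * B k j))"

definition iid :: "'a::comm_ring_1 imat" where
  "iid = (\<lambda>i j. if i = j then 1 else 0)"

definition iprod :: "'a::comm_ring_1 imat list \<Rightarrow> 'a imat" where
  "iprod Ms = foldr imult Ms iid"

definition minor :: "'a::comm_ring_1 imat \<Rightarrow> nat \<Rightarrow> (nat \<Rightarrow> nat) \<Rightarrow> (nat \<Rightarrow> nat) \<Rightarrow> 'a" where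
  "minor M s \<rho> \<gamma> = det (mat s s (\<lambda>(i, j). M (\<rho> i) (\<gamma> j)))"

definition cw_TP :: "nat \<Rightarrow> 'z mpol imat \<Rightarrow> bool" where
  "cw_TP r M \<longleftrightarrow> (\<forall>s \<rho> \<gamma>. 1 \<le> s \<and> s \<le> r \<and> strict_mono_on {..<s} \<rho> \<and> strict_mono_on {..<s} \<gamma>
      \<longrightarrow> cw_nonneg (minor M s \<rho> \<gamma>))"

definition hankel :: "(nat \<Rightarrow> 'a) \<Rightarrow> 'a imat" where
  "hankel s = (\<lambda>i j. s (i + j))"

definition cw_Hankel_TP :: "nat \<Rightarrow> (nat \<Rightarrow> 'z mpol) \<Rightarrow> bool" where
  "cw_Hankel_TP r s \<longleftrightarrow> cw_TP r (hankel s)"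

definition toeplitz :: "'a::zero fps \<Rightarrow> 'a imat" where
  "toeplitz f = (\<lambda>i j. if j \<le> i then fps_nth f (i - j) else 0)"

definition Gamma_Lam :: "'z mpol fps \<Rightarrow> 'z mpol imat" where
  "Gamma_Lam f = (\<lambda>i j. Const (fact i / fact j) * toeplitz f i j)"

definition Lmat :: "'a::comm_ring_1 \<Rightarrow> 'a \<Rightarrow> 'a \<Rightarrow> 'a imat" where
  "Lmat a b c = (\<lambda>i j. if j = i then of_nat i * a + b
                       else if i = Suc j then of_nat i * c
                       else 0)"

definition Jmat :: "'a::comm_ring_1 \<Rightarrow> 'a \<Rightarrow> 'a \<Rightarrow> 'a \<Rightarrow> 'a \<Rightarrow> 'a imat" where
  "Jmat a b u v l = (\<lambda>i j.
     if j = Suc i then u * of_nat i + u + v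
     else if j = i then (2 * l * u + a) * of_nat i + b + l * (u + v)
     else if i = Suc j then l * (a + l * u) * of_nat i
     else 0)"

definition binom_mat :: "'a::comm_ring_1 \<Rightarrow> 'a imat" where
  "binom_mat q = (\<lambda>n k. of_nat (n choose k) * q ^ (n - k))"

definition binom_row_gen_mat :: "'a::comm_ring_1 imat \<Rightarrow> 'a \<Rightarrow> 'a imat" where
  "binom_row_gen_mat M q = imult M (binom_mat q)"

definition row_gen :: "'a::comm_ring_1 imat \<Rightarrow> 'a \<Rightarrow> nat \<Rightarrow> 'a" where
  "row_gen M q n = Sum_any (\<lambda>k. M n k * q ^ k)"

text \<open>A path is the list of the heights \<open>h\<^sub>0, \<dots>, h\<^sub>n\<close> of its vertices \<open>(i, h\<^sub>i)\<close>. The subtraction in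
  the step condition is truncated, so it is the depth of a fall and \<open>0\<close> for rises and level steps.\<close>

definition luka_step :: "enat \<Rightarrow> nat \<Rightarrow> nat \<Rightarrow> bool" where
  "luka_step m h h' \<longleftrightarrow> h' \<le> Suc h \<and> enat (h - h') \<le> m"

definition luka_paths :: "enat \<Rightarrow> nat \<Rightarrow> nat \<Rightarrow> nat list set" where
  "luka_paths m n k = {hs. length hs = Suc n \<and> hs ! 0 = 0 \<and> hs ! n = k
                         \<and> (\<forall>i<n. luka_step m (hs ! i) (hs ! Suc i))}"

text \<open>The weight \<open>\<beta>\<^sub>i\<close> with upper index \<open>\<ell>\<close> is written \<open>\<beta> \<ell> i\<close>; only the values with
  \<open>-1 \<le> \<ell> \<le> m\<close> and \<open>\<ell> \<le> i\<close> are ever used.\<close>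

definition step_weight :: "enat \<Rightarrow> (int \<Rightarrow> nat \<Rightarrow> 'a::comm_ring_1) \<Rightarrow> nat \<Rightarrow> nat \<Rightarrow> 'a" where
  "step_weight m \<beta> h h' = (if h' = Suc h then (if m = 1 then \<beta> (-1) h else 1)
                           else \<beta> (int h - int h') h)"

definition jacobi_rogers :: "enat \<Rightarrow> (int \<Rightarrow> nat \<Rightarrow> 'a::comm_ring_1) \<Rightarrow> 'a imat" where
  "jacobi_rogers m \<beta> = (\<lambda>n k. \<Sum>hs \<in> luka_paths m n k. \<Prod>i<n. step_weight m \<beta> (hs ! i) (hs ! Suc i))"

definition luka_P :: "enat \<Rightarrow> (int \<Rightarrow> nat \<Rightarrow> 'a::comm_ring_1) \<Rightarrow> 'a imat" where
  "luka_P m \<beta> = (\<lambda>i j. if j = Suc i then (if m = 1 then \<beta> (-1) i else 1)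
                       else if j \<le> i \<and> enat (i - j) \<le> m then \<beta> (int i - int j) i
                       else 0)"

text \<open>The indeterminates \<open>a, b, u, v, \<lambda>\<close>, the three hatted families (indexed from \<open>1\<close>), the
  set \<open>\<^bold>x\<close>, and \<open>q\<close>.\<close>

datatype param = PA | PB | PU | PV | PLam | PAhat nat | PBhat nat | PChat nat

datatype 'x indet = Param param | X 'x | Q

text \<open>Values for the parameters. The generic choice is the indeterminates themselves
  (\<open>specialization_generic\<close> below). Other choices have to be admitted because for \<open>m > 1\<close> the
  superdiagonal of the production matrix is \<open>1\<close>, which forces specializations such as
  \<open>u = 0, v = 1\<close>.\<close>

definition specialization :: "(param \<Rightarrow> 'x indet mpol) \<Rightarrow> bool" where
  "specialization \<sigma> \<longleftrightarrow> (\<forall>p. cw_nonneg (\<sigma> p) \<and> Q \<notin> indets (\<sigma> p))"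

lemma specialization_generic: "specialization (\<lambda>p. Var (Param p))"
  by (auto simp: specialization_def cw_nonneg_def indets_def Var_def lookup_single when_def)

definition x_Polya_frequency :: "nat \<Rightarrow> 'x indet mpol fps \<Rightarrow> bool" where
  "x_Polya_frequency r f \<longleftrightarrow> (\<forall>n. indets (fps_nth f n) \<subseteq> range X) \<and> cw_TP r (toeplitz f)"

end

theory Submission
  imports Defs
begin

text \<open>Row \<open>n\<close> of the triangle \<open>J\<close> is row \<open>0\<close> of \<open>P\<^sup>n\<close>. Since row \<open>0\<close> of \<open>B\<^sub>q\<close> is \<open>e\<^sub>0\<close>, row \<open>n\<close> of \<open>J B\<^sub>q\<close> is
  row \<open>0\<close> of the \<open>n\<close>-th power of the conjugate of \<open>P\<close> by \<open>B\<^sub>q\<close>. Conjugation by \<open>B\<^sub>q\<close> preserves the three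
  kinds of factors: it sends \<open>J(a,b,u,v,\<lambda>)\<close> to \<open>J(a,b,u,v,\<lambda>+q)\<close> and \<open>L(a,b,c)\<close> to \<open>L(a,b,c+aq)\<close>, and it
  fixes the matrices \<open>\<Lambda> \<Gamma>(f) \<Lambda>\<^bsup>-1\<^esup>\<close>. All of them are coefficientwise totally positive, hence by
  Cauchy-Binet so is the conjugate of \<open>P\<close>, its output matrix, and the Hankel matrix of the zeroth column
  of the output matrix.\<close>

section \<open>Coefficientwise nonnegative polynomials\<close>


lemma cw_nonneg_0 [simp]: "cw_nonneg 0"
  by (simp add: cw_nonneg_def)

lemma cw_nonneg_1 [simp]: "cw_nonneg 1"
  by (simp add: cw_nonneg_def lookup_one when_def)

lemma cw_nonneg_of_nat [simp]: "cw_nonneg (of_nat n)"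
  by (simp add: cw_nonneg_def lookup_of_nat when_def)

lemma cw_nonneg_Const: "0 \<le> c \<Longrightarrow> cw_nonneg (Const c)"
  by (simp add: cw_nonneg_def Const_def lookup_single when_def)

lemma cw_nonneg_Var [simp]: "cw_nonneg (Var z)"
  by (simp add: cw_nonneg_def Var_def lookup_single when_def)

lemma cw_nonneg_add: "cw_nonneg p \<Longrightarrow> cw_nonneg q \<Longrightarrow> cw_nonneg (p + q)"
  by (simp add: cw_nonneg_def lookup_add)

lemma Sum_any_nonneg:
  fixes g :: "'b \<Rightarrow> real"
  shows "(\<And>x. 0 \<le> g x) \<Longrightarrow> 0 \<le> Sum_any g"
  unfolding Sum_any.expand_set by (rule sum_nonneg) auto

lemma cw_nonneg_mult: "cw_nonneg p \<Longrightarrow> cw_nonneg q \<Longrightarrow> cw_nonneg (p * q)"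
  unfolding cw_nonneg_def lookup_mult
  by (intro allI Sum_any_nonneg mult_nonneg_nonneg) (auto simp: when_def)

lemma cw_nonneg_sum: "(\<And>x. x \<in> A \<Longrightarrow> cw_nonneg (g x)) \<Longrightarrow> cw_nonneg (sum g A)"
  by (induction A rule: infinite_finite_induct) (auto intro: cw_nonneg_add)

lemma cw_nonneg_prod: "(\<And>x. x \<in> A \<Longrightarrow> cw_nonneg (g x)) \<Longrightarrow> cw_nonneg (prod g A)"
  by (induction A rule: infinite_finite_induct) (auto intro: cw_nonneg_mult)

section \<open>Products of row-finite matrices\<close>

text \<open>\<open>Sum_any\<close> is 0 when infinitely many summands are nonzero, so
  \<open>imult\<close> is a genuine matrix product only under a finiteness condition such as this
  one on the left factor.\<close>

definition row_finite :: "'a::zero imat \<Rightarrow> bool" where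
  "row_finite M \<longleftrightarrow> (\<forall>i. finite {k. M i k \<noteq> 0})"

lemma row_finiteI: "(\<And>i k. k \<notin> S i \<Longrightarrow> M i k = 0) \<Longrightarrow> (\<And>i. finite (S i)) \<Longrightarrow> row_finite M"
  unfolding row_finite_def by (metis (mono_tags, lifting) finite_subset mem_Collect_eq subsetI)

lemma imult_eq_sum:
  assumes "finite S" "\<And>k. k \<notin> S \<Longrightarrow> M i k = 0"
  shows "imult M N i j = (\<Sum>k\<in>S. M i k * N k j)"
  unfolding imult_def
  by (rule Sum_any.expand_superset) (use assms in \<open>auto, metis mult_zero_left\<close>)

lemma imult_eq_support_sum:
  "row_finite M \<Longrightarrow> imult M N i j = (\<Sum>k\<in>{k. M i k \<noteq> 0}. M i k * N k j)"
  by (rule imult_eq_sum) (auto simp: row_finite_def)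

lemma row_finite_imult:
  assumes "row_finite M" "row_finite N"
  shows "row_finite (imult M N)"
proof (rule row_finiteI)
  fix i show "finite (\<Union>k\<in>{k. M i k \<noteq> 0}. {l. N k l \<noteq> 0})"
    using assms by (auto simp: row_finite_def)
  show "imult M N i j = 0" if "j \<notin> (\<Union>k\<in>{k. M i k \<noteq> 0}. {l. N k l \<noteq> 0})" for j
    using that by (auto simp: imult_eq_support_sum[OF assms(1)] intro!: sum.neutral)
qed

text \<open>Row \<open>i\<close> of either side is the same double sum over the finite sets
  \<open>S\<close> and \<open>T\<close>. Nothing is asked of \<open>K\<close>: it will also be a
  matrix with columns P^n e_0, whose rows may be infinite.\<close>

lemma imult_assoc:
  assumes M: "row_finite M" and N: "row_finite N"
  shows "imult (imult M N) K = imult M (imult N K)"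
proof (intro ext)
  fix i j
  define S where "S = {k. M i k \<noteq> 0}"
  define T where "T = (\<Union>k\<in>S. {l. N k l \<noteq> 0})"
  have fin: "finite S" "finite T"
    using assms by (auto simp: row_finite_def S_def T_def)
  have MN: "imult M N i l = (\<Sum>k\<in>S. M i k * N k l)" for l
    unfolding S_def by (rule imult_eq_support_sum[OF M])
  have "imult (imult M N) K i j = (\<Sum>l\<in>T. imult M N i l * K l j)"
    by (rule imult_eq_sum) (use fin in \<open>auto simp: MN T_def intro!: sum.neutral\<close>)
  also have "\<dots> = (\<Sum>k\<in>S. \<Sum>l\<in>T. M i k * (N k l * K l j))"
    unfolding MN by (subst sum.swap) (simp add: sum_distrib_right mult.assoc)
  also have "\<dots> = (\<Sum>k\<in>S. M i k * imult N K k j)"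
  proof (rule sum.cong[OF refl])
    fix k assume "k \<in> S"
    then have "imult N K k j = (\<Sum>l\<in>T. N k l * K l j)"
      by (intro imult_eq_sum) (use fin in \<open>auto simp: T_def\<close>)
    then show "(\<Sum>l\<in>T. M i k * (N k l * K l j)) = M i k * imult N K k j"
      by (simp add: sum_distrib_left)
  qed
  also have "\<dots> = imult M (imult N K) i j"
    unfolding S_def by (rule imult_eq_support_sum[OF M, symmetric])
  finally show "imult (imult M N) K i j = imult M (imult N K) i j" .
qed

lemma row_finite_iid: "row_finite iid"
  by (rule row_finiteI[where S = "\<lambda>i. {i}"]) (auto simp: iid_def)

lemma imult_iid_left: "imult iid M = M"
  by (intro ext, subst imult_eq_sum[where S = "{i}" for i]) (auto simp: iid_def)

lemma imult_iid_right: "row_finite M \<Longrightarrow> imult M iid = M"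
proof (intro ext)
  fix i j assume M: "row_finite M"
  have "imult M iid i j = (\<Sum>k\<in>insert j {k. M i k \<noteq> 0}. M i k * iid k j)"
    by (rule imult_eq_sum) (use M in \<open>auto simp: row_finite_def\<close>)
  also have "\<dots> = (\<Sum>k\<in>{j}. M i k * iid k j)"
    by (rule sum.mono_neutral_right) (use M in \<open>auto simp: row_finite_def iid_def\<close>)
  finally show "imult M iid i j = M i j" by (simp add: iid_def)
qed

section \<open>Minors and the Cauchy-Binet formula\<close>

lemma minor_leibniz:
  "minor M s \<rho> \<gamma> = (\<Sum>p | p permutes {..<s}. of_int (sign p) * (\<Prod>i<s. M (\<rho> i) (\<gamma> (p i))))"
proof -
  have "minor M s \<rho> \<gamma> = (\<Sum>p | p permutes {0..<s}. of_int (sign p) *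
      (\<Prod>i=0..<s. mat s s (\<lambda>(i, j). M (\<rho> i) (\<gamma> j)) $$ (i, p i)))"
    unfolding minor_def by (rule det_def') simp
  also have "\<dots> = (\<Sum>p | p permutes {0..<s}. of_int (sign p) * (\<Prod>i=0..<s. M (\<rho> i) (\<gamma> (p i))))"
    by (intro sum.cong refl arg_cong2[of _ _ _ _ "(*)"] prod.cong)
      (simp add: permutes_in_image)
  finally show ?thesis by (simp add: atLeast0LessThan)
qed

lemma minor_transpose: "minor (\<lambda>i j. M j i) s \<rho> \<gamma> = minor M s \<gamma> \<rho>"
proof -
  have "mat s s (\<lambda>(i, j). M (\<gamma> j) (\<rho> i)) = transpose_mat (mat s s (\<lambda>(i, j). M (\<gamma> i) (\<rho> j)))"
    by (rule eq_matI) auto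
  then show ?thesis
    unfolding minor_def by (metis det_transpose mat_carrier)
qed

lemma minor_permute_rows:
  assumes "p permutes {..<s}" "\<And>i. i < s \<Longrightarrow> \<rho>' i = \<rho> (p i)"
  shows "minor M s \<rho>' \<gamma> = of_int (sign p) * minor M s \<rho> \<gamma>"
proof -
  let ?A = "mat s s (\<lambda>(i, j). M (\<rho> i) (\<gamma> j))"
  have p: "p permutes {0..<s}" using assms(1) by (simp add: atLeast0LessThan)
  have "mat s s (\<lambda>(i, j). M (\<rho>' i) (\<gamma> j)) = mat s s (\<lambda>(i, j). ?A $$ (p i, j))"
    by (rule eq_matI) (use assms p in \<open>auto simp: permutes_in_image\<close>)
  then show ?thesis
    unfolding minor_def using det_permute_rows[OF _ p, of ?A] by simp
qed

lemma minor_eq_0_if_not_inj: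
  assumes "\<not> inj_on \<rho> {..<s}"
  shows "minor M s \<rho> \<gamma> = 0"
proof -
  obtain i j where "i < s" "j < s" "i \<noteq> j" "\<rho> i = \<rho> j"
    using assms by (auto simp: inj_on_def)
  then show ?thesis
    unfolding minor_def by (intro det_identical_rows[where i = i and j = j]) auto
qed

text \<open>Each selected row of the product is a finite combination of rows of \<open>N\<close>.
  Multilinearity of the determinant gives one term for every choice \<open>g\<close> of a row of
  \<open>N\<close> at each position.\<close>

lemma minor_imult_expand_rows:
  assumes "finite S" "\<And>i k. i < s \<Longrightarrow> k \<notin> S \<Longrightarrow> M (\<rho> i) k = 0"
  shows "minor (imult M N) s \<rho> \<gamma> =
    (\<Sum>g\<in>{..<s} \<rightarrow>\<^sub>E S. (\<Prod>i<s. M (\<rho> i) (g i)) * minor N s g \<gamma>)"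
proof -
  have "(\<Prod>i<s. imult M N (\<rho> i) (\<gamma> (p i))) =
      (\<Sum>g\<in>{..<s} \<rightarrow>\<^sub>E S. (\<Prod>i<s. M (\<rho> i) (g i)) * (\<Prod>i<s. N (g i) (\<gamma> (p i))))" for p
  proof -
    have "(\<Prod>i<s. imult M N (\<rho> i) (\<gamma> (p i))) = (\<Prod>i<s. \<Sum>k\<in>S. M (\<rho> i) k * N k (\<gamma> (p i)))"
      by (intro prod.cong refl imult_eq_sum) (use assms in auto)
    also have "\<dots> = (\<Sum>g\<in>{..<s} \<rightarrow>\<^sub>E S. \<Prod>i<s. M (\<rho> i) (g i) * N (g i) (\<gamma> (p i)))"
      by (rule prod_sum_PiE) (use assms in auto)
    finally show ?thesis by (simp add: prod.distrib)
  qed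
  then have "minor (imult M N) s \<rho> \<gamma> = (\<Sum>p | p permutes {..<s}. \<Sum>g\<in>{..<s} \<rightarrow>\<^sub>E S.
      of_int (sign p) * ((\<Prod>i<s. M (\<rho> i) (g i)) * (\<Prod>i<s. N (g i) (\<gamma> (p i)))))"
    by (simp only: minor_leibniz sum_distrib_left)
  also have "\<dots> = (\<Sum>g\<in>{..<s} \<rightarrow>\<^sub>E S. (\<Prod>i<s. M (\<rho> i) (g i)) * minor N s g \<gamma>)"
    by (subst sum.swap) (simp only: minor_leibniz sum_distrib_left mult_ac)
  finally show ?thesis .
qed

text \<open>Choices \<open>g\<close> that repeat a row give a vanishing minor of \<open>N\<close>.
  The injective ones are grouped by their image \<open>K\<close>: there \<open>g\<close> is the
  increasing enumeration of \<open>K\<close> after a permutation \<open>p\<close>, sorting the rows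
  costs \<open>sign p\<close>, and the signed sum over \<open>p\<close> is a minor of
  \<open>M\<close>.\<close>

theorem cauchy_binet_imult:
  assumes "finite S" "\<And>i k. i < s \<Longrightarrow> k \<notin> S \<Longrightarrow> M (\<rho> i) k = 0"
  shows "minor (imult M N) s \<rho> \<gamma> =
    (\<Sum>K | K \<subseteq> S \<and> card K = s. minor M s \<rho> (enumerate K) * minor N s (enumerate K) \<gamma>)"
proof -
  let ?I = "{g \<in> {..<s} \<rightarrow>\<^sub>E S. inj_on g {..<s}}"
  let ?h = "\<lambda>g. (\<Prod>i<s. M (\<rho> i) (g i)) * minor N s g \<gamma>"
  let ?KK = "{K. K \<subseteq> S \<and> card K = s}"
  have fin: "finite ({..<s} \<rightarrow>\<^sub>E S)" by (intro finite_PiE) (use assms in auto)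
  then have finI: "finite ?I" by (rule finite_subset[rotated]) auto
  have "minor (imult M N) s \<rho> \<gamma> = (\<Sum>g\<in>{..<s} \<rightarrow>\<^sub>E S. ?h g)"
    by (rule minor_imult_expand_rows) (use assms in auto)
  also have "\<dots> = sum ?h ?I"
    by (rule sum.mono_neutral_right) (use fin in \<open>auto simp: minor_eq_0_if_not_inj\<close>)
  also have "\<dots> = (\<Sum>K\<in>?KK. sum ?h {g \<in> ?I. g ` {..<s} = K})"
  proof (rule sum.group[OF finI, symmetric])
    show "finite ?KK" by (rule finite_subset[of _ "Pow S"]) (use assms(1) in auto)
    show "(\<lambda>g. g ` {..<s}) ` ?I \<subseteq> ?KK"
    proof (rule image_subsetI)
      fix g assume "g \<in> ?I"
      then have "g ` {..<s} \<subseteq> S" "card (g ` {..<s}) = s"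
        by (auto simp: card_image PiE_iff)
      then show "g ` {..<s} \<in> ?KK" by simp
    qed
  qed
  also have "\<dots> = (\<Sum>K\<in>?KK. minor M s \<rho> (enumerate K) * minor N s (enumerate K) \<gamma>)"
  proof (rule sum.cong[OF refl])
    fix K assume "K \<in> ?KK"
    then have K: "K \<subseteq> S" "card K = s" "finite K" using assms(1) finite_subset by auto
    define e where "e = enumerate K"
    have e: "bij_betw e {..<s} K"
      unfolding e_def using finite_bij_enumerate[OF K(3)] K(2) by simp
    \<comment> \<open>\<open>F\<close> and \<open>G\<close> are mutually inverse. The extensional
      function space demands the \<open>restrict\<close> in \<open>F\<close>, and
      \<open>permutes\<close> demands that \<open>G g\<close> be the identity from \<open>s\<close>
      on.\<close>
    define F where "F = (\<lambda>p. restrict (e \<circ> p) {..<s})"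
    define G where "G = (\<lambda>g i. if i < s then the_inv_into {..<s} e (g i) else i)"
    have "sum ?h {g \<in> ?I. g ` {..<s} = K} =
        (\<Sum>p | p permutes {..<s}. of_int (sign p) * (\<Prod>i<s. M (\<rho> i) (e (p i))) * minor N s e \<gamma>)"
    proof (rule sum.reindex_bij_witness[where j = G and i = F])
      fix p assume "p \<in> {p. p permutes {..<s}}"
      then have p: "p permutes {..<s}" by simp
      have pb: "bij_betw p {..<s} {..<s}" by (rule permutes_imp_bij[OF p])
      have F: "bij_betw (F p) {..<s} K"
        unfolding F_def using bij_betw_trans[OF pb e]
        by (subst bij_betw_cong[where g = "e \<circ> p"]) auto
      have "F p i \<in> S" if "i < s" for i
        using F that K(1) by (auto simp: bij_betw_def)
      then show "F p \<in> {g \<in> ?I. g ` {..<s} = K}"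
        using F by (auto simp: bij_betw_def F_def)
      have ps: "p i < s \<longleftrightarrow> i < s" for i using permutes_in_image[OF p, of i] by simp
      show "G (F p) = p"
        by (rule ext) (use e ps p in \<open>auto simp: G_def F_def bij_betw_def the_inv_into_f_f permutes_def\<close>)
    next
      fix g assume "g \<in> {g \<in> ?I. g ` {..<s} = K}"
      then have g: "g \<in> {..<s} \<rightarrow>\<^sub>E S" "bij_betw g {..<s} K" by (auto simp: bij_betw_def)
      have "bij_betw (the_inv_into {..<s} e \<circ> g) {..<s} {..<s}"
        by (rule bij_betw_trans[OF g(2) bij_betw_the_inv_into[OF e]])
      then have "bij_betw (G g) {..<s} {..<s}"
        by (subst bij_betw_cong[where g = "the_inv_into {..<s} e \<circ> g"]) (auto simp: G_def)
      then have Gp: "G g permutes {..<s}"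
        by (rule bij_imp_permutes) (auto simp: G_def)
      then show "G g \<in> {p. p permutes {..<s}}" by simp
      have eG: "e (G g i) = g i" if "i < s" for i
        using that e g(2) by (auto simp: G_def bij_betw_def intro!: f_the_inv_into_f)
      then show "F (G g) = g"
        using g(1) by (auto simp: F_def PiE_def extensional_def)
      show "of_int (sign (G g)) * (\<Prod>i<s. M (\<rho> i) (e (G g i))) * minor N s e \<gamma> = ?h g"
        using minor_permute_rows[OF Gp, of g e N \<gamma>] eG by (simp add: mult_ac)
    qed
    also have "\<dots> = minor M s \<rho> e * minor N s e \<gamma>"
      unfolding minor_leibniz[of M] by (rule sum_distrib_right[symmetric])
    finally show "sum ?h {g \<in> ?I. g ` {..<s} = K} = minor M s \<rho> (enumerate K) * minor N s (enumerate K) \<gamma>"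
      unfolding e_def .
  qed
  finally show ?thesis .
qed

lemma minor_reindex:
  assumes "\<And>i j. i < s \<Longrightarrow> j < s \<Longrightarrow> M (\<rho> i) (\<gamma> j) = M' (\<rho>' i) (\<gamma>' j)"
  shows "minor M s \<rho> \<gamma> = minor M' s \<rho>' \<gamma>'"
  unfolding minor_def by (rule arg_cong[where f = det], rule eq_matI) (use assms in auto)

lemma cw_TP_transpose: "cw_TP r M \<Longrightarrow> cw_TP r (\<lambda>i j. M j i)"
  unfolding cw_TP_def by (subst minor_transpose) blast

text \<open>Cauchy-Binet keeps the size of the minors, so the order \<open>r\<close> is preserved.
  It applies because the finitely many rows in a minor have a finite joint support.\<close>

lemma cw_TP_imult:
  assumes "cw_TP r M" "cw_TP r N" "row_finite M"
  shows "cw_TP r (imult M N)"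
  unfolding cw_TP_def
proof (intro allI impI)
  fix s and \<rho> \<gamma> :: "nat \<Rightarrow> nat"
  assume *: "1 \<le> s \<and> s \<le> r \<and> strict_mono_on {..<s} \<rho> \<and> strict_mono_on {..<s} \<gamma>"
  define S where "S = (\<Union>i<s. {k. M (\<rho> i) k \<noteq> 0})"
  have S: "finite S" using assms(3) by (auto simp: S_def row_finite_def)
  have "strict_mono_on {..<s} (enumerate K)" if "K \<subseteq> S" "card K = s" for K
    using that S by (auto intro!: strict_mono_onI finite_enumerate_mono simp: finite_subset)
  then show "cw_nonneg (minor (imult M N) s \<rho> \<gamma>)"
    using assms(1,2) * unfolding cw_TP_def
    by (subst cauchy_binet_imult[OF S])
      (auto simp: S_def intro!: cw_nonneg_sum cw_nonneg_mult)
qed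

text \<open>Only the identity permutation contributes to the Leibniz expansion of a minor.\<close>

lemma cw_TP_noncrossing:
  assumes nonneg: "\<And>i j. cw_nonneg (M i j)"
    and noncrossing: "\<And>i i' j j'. i < i' \<Longrightarrow> j < j' \<Longrightarrow> M i j' * M i' j = 0"
  shows "cw_TP r M"
  unfolding cw_TP_def
proof (intro allI impI)
  fix s and \<rho> \<gamma> :: "nat \<Rightarrow> nat"
  assume *: "1 \<le> s \<and> s \<le> r \<and> strict_mono_on {..<s} \<rho> \<and> strict_mono_on {..<s} \<gamma>"
  have "(\<Prod>i<s. M (\<rho> i) (\<gamma> (p i))) = 0" if p: "p permutes {..<s}" "p \<noteq> id" for p
  proof -
    have ps: "p i < s \<longleftrightarrow> i < s" for i using permutes_in_image[OF p(1), of i] by simp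
    \<comment> \<open>A permutation of {..<s} without inversions is strictly increasing, so p i
      \<ge> i everywhere, which forces the identity.\<close>
    have "\<exists>i j. i < j \<and> j < s \<and> p j < p i"
    proof (rule ccontr)
      assume "\<nexists>i j. i < j \<and> j < s \<and> p j < p i"
      then have "strict_mono_on {..<s} p"
        using permutes_inj[OF p(1)]
        by (auto intro!: strict_mono_onI simp: inj_def) (metis linorder_neqE_nat nat_less_le)
      then have mono: "p i < p j" if "i < j" "j < s" for i j
        using that by (auto simp: strict_mono_on_def)
      have "i \<le> p i" if "i < s" for i
        using that
      proof (induction i)
        case (Suc i)
        with mono[of i "Suc i"] show ?case by simp
      qed simp
      then show False using p permutes_natset_ge[of p "{..<s}"] by auto
    qed
    then obtain i j where ij: "i < j" "j < s" "p j < p i" by blast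
    \<comment> \<open>At an inversion the two entries chosen by \<open>p\<close> cross, which kills
      the whole product.\<close>
    have "M (\<rho> i) (\<gamma> (p i)) * M (\<rho> j) (\<gamma> (p j)) = 0"
      by (rule noncrossing) (use * ij ps in \<open>auto simp: strict_mono_on_def\<close>)
    moreover have "(\<Prod>i<s. M (\<rho> i) (\<gamma> (p i))) =
        (M (\<rho> i) (\<gamma> (p i)) * M (\<rho> j) (\<gamma> (p j))) * (\<Prod>i\<in>{..<s} - {i} - {j}. M (\<rho> i) (\<gamma> (p i)))"
      using ij by (subst prod.remove[of _ i], simp, simp, subst prod.remove[of _ j]) (auto simp: mult.assoc)
    ultimately show ?thesis by simp
  qed
  then have "minor M s \<rho> \<gamma> = (\<Sum>p\<in>{id}. of_int (sign p) * (\<Prod>i<s. M (\<rho> i) (\<gamma> (p i))))"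
    unfolding minor_leibniz
    by (intro sum.mono_neutral_right) (auto simp: finite_permutations permutes_id)
  then show "cw_nonneg (minor M s \<rho> \<gamma>)"
    by (auto simp: sign_id nonneg intro!: cw_nonneg_prod)
qed


section \<open>Output matrices\<close>

text \<open>Serves twice: \<open>border P\<close> has e_0 as an extra top row, while
  \<open>border (shift_cols M)\<close> is the direct sum of the 1 x 1 identity and
  \<open>M\<close>.\<close>

definition border :: "'a::comm_ring_1 imat \<Rightarrow> 'a imat" where
  "border M = (\<lambda>i j. case i of 0 \<Rightarrow> if j = 0 then 1 else 0 | Suc i' \<Rightarrow> M i' j)"

definition shift_cols :: "'a::comm_ring_1 imat \<Rightarrow> 'a imat" where
  "shift_cols M = (\<lambda>i j. case j of 0 \<Rightarrow> 0 | Suc j' \<Rightarrow> M i j')"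

lemma strict_mono_on_pos:
  fixes \<rho> :: "nat \<Rightarrow> nat"
  shows "strict_mono_on {..<s} \<rho> \<Longrightarrow> 0 < \<rho> 0 \<Longrightarrow> i < s \<Longrightarrow> 0 < \<rho> i"
  by (cases "i = 0") (auto dest: strict_mono_onD[where r = 0 and s = i])

lemma strict_mono_on_pred:
  fixes \<rho> :: "nat \<Rightarrow> nat"
  assumes "strict_mono_on {..<s} \<rho>" "0 < \<rho> 0"
  shows "strict_mono_on {..<s} (\<lambda>i. \<rho> i - 1)"
proof (rule strict_mono_onI)
  fix i j assume "i \<in> {..<s}" "j \<in> {..<s}" "i < j"
  then have "0 < \<rho> i" "\<rho> i < \<rho> j"
    using assms strict_mono_on_pos[OF assms, of i] by (auto simp: strict_mono_on_def)
  then show "\<rho> i - 1 < \<rho> j - 1" by simp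
qed

text \<open>Since \<gamma> increases, the zero column can only come first. A minor avoiding it is a
  minor of \<open>M\<close> with all column indices lowered by one.\<close>

lemma cw_TP_shift_cols:
  assumes "cw_TP r M"
  shows "cw_TP r (shift_cols M)"
  unfolding cw_TP_def
proof (intro allI impI)
  fix s and \<rho> \<gamma> :: "nat \<Rightarrow> nat"
  assume *: "1 \<le> s \<and> s \<le> r \<and> strict_mono_on {..<s} \<rho> \<and> strict_mono_on {..<s} \<gamma>"
  show "cw_nonneg (minor (shift_cols M) s \<rho> \<gamma>)"
  proof (cases "\<gamma> 0 = 0")
    case True
    then have "minor (shift_cols M) s \<rho> \<gamma> = 0"
      unfolding minor_def using *
      by (subst laplace_expansion_column[where j = 0 and n = s]) (auto simp: shift_cols_def)
    then show ?thesis by simp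
  next
    case False
    then have pos: "\<gamma> i \<noteq> 0" if "i < s" for i
      using * strict_mono_on_pos[of s \<gamma> i] that by simp
    have "minor (shift_cols M) s \<rho> \<gamma> = minor M s \<rho> (\<lambda>i. \<gamma> i - 1)"
      by (intro minor_reindex) (auto simp: shift_cols_def dest: pos split: nat.splits)
    then show ?thesis
      using assms * False strict_mono_on_pred[of s \<gamma>] by (simp add: cw_TP_def)
  qed
qed

text \<open>A minor without the top row is a minor of \<open>M\<close>. Otherwise Laplace expansion
  along the top row leaves only its first entry, because \<gamma> increases and so only \<gamma> 0
  can be 0; the cofactor is a minor of \<open>M\<close> of size one less.\<close>

lemma cw_TP_border:
  assumes "cw_TP r M"
  shows "cw_TP r (border M)"
  unfolding cw_TP_def
proof (intro allI impI)
  fix s and \<rho> \<gamma> :: "nat \<Rightarrow> nat"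
  assume *: "1 \<le> s \<and> s \<le> r \<and> strict_mono_on {..<s} \<rho> \<and> strict_mono_on {..<s} \<gamma>"
  show "cw_nonneg (minor (border M) s \<rho> \<gamma>)"
  proof (cases "\<rho> 0 = 0")
    case False
    then have pos: "\<rho> i \<noteq> 0" if "i < s" for i
      using * strict_mono_on_pos[of s \<rho> i] that by simp
    have "minor (border M) s \<rho> \<gamma> = minor M s (\<lambda>i. \<rho> i - 1) \<gamma>"
      by (intro minor_reindex) (auto simp: border_def dest: pos split: nat.splits)
    then show ?thesis
      using assms * False strict_mono_on_pred[of s \<rho>] by (simp add: cw_TP_def)
  next
    case True
    let ?A = "mat s s (\<lambda>(i, j). border M (\<rho> i) (\<gamma> j))"
    obtain t where t: "s = Suc t" using * by (cases s) auto
    have "minor (border M) s \<rho> \<gamma> = (\<Sum>j<s. ?A $$ (0, j) * cofactor ?A 0 j)"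
      unfolding minor_def using * by (intro laplace_expansion_row) auto
    also have "\<dots> = ?A $$ (0, 0) * cofactor ?A 0 0"
    proof -
      have "?A $$ (0, j) = 0" if "j < s" "j \<noteq> 0" for j
        using that True * strict_mono_onD[of "{..<s}" \<gamma> 0 j] by (simp add: border_def)
      then have "(\<Sum>j<s. ?A $$ (0, j) * cofactor ?A 0 j) = (\<Sum>j\<in>{0}. ?A $$ (0, j) * cofactor ?A 0 j)"
        using * by (intro sum.mono_neutral_right) auto
      then show ?thesis by simp
    qed
    also have "cofactor ?A 0 0 = minor M t (\<lambda>i. \<rho> (Suc i) - 1) (\<lambda>j. \<gamma> (Suc j))"
    proof -
      have pos: "\<rho> (Suc i) \<noteq> 0" if "i < t" for i
        using that * t strict_mono_onD[of "{..<s}" \<rho> 0 "Suc i"] by simp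
      have "mat_delete ?A 0 0 = mat t t (\<lambda>(i, j). M (\<rho> (Suc i) - 1) (\<gamma> (Suc j)))"
        unfolding mat_delete_def t
        by (intro eq_matI) (auto simp: border_def dest: pos split: nat.splits)
      then show ?thesis by (simp add: cofactor_def minor_def)
    qed
    also have "cw_nonneg (?A $$ (0, 0) * minor M t (\<lambda>i. \<rho> (Suc i) - 1) (\<lambda>j. \<gamma> (Suc j)))"
    proof (rule cw_nonneg_mult)
      show "cw_nonneg (?A $$ (0, 0))" using True t by (simp add: border_def)
      have pos: "0 < \<rho> (Suc 0)" if "1 \<le> t"
        using that * t strict_mono_onD[of "{..<s}" \<rho> 0 "Suc 0"] by simp
      have "strict_mono_on {..<t} (\<lambda>i. \<rho> (Suc i))" "strict_mono_on {..<t} (\<lambda>j. \<gamma> (Suc j))"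
        using * t by (auto simp: strict_mono_on_def)
      \<comment> \<open>For \<open>t = 0\<close> the remaining minor is the empty determinant 1, a
        size about which \<open>cw_TP\<close> says nothing.\<close>
      then show "cw_nonneg (minor M t (\<lambda>i. \<rho> (Suc i) - 1) (\<lambda>j. \<gamma> (Suc j)))"
        using assms * t pos strict_mono_on_pred[of t "\<lambda>i. \<rho> (Suc i)"]
        by (cases "t = 0") (simp_all add: cw_TP_def minor_def)
    qed
    finally show ?thesis .
  qed
qed

text \<open>A minor meets finitely many rows. This makes induction on the number of rows possible
  for a matrix given by a row recursion.\<close>

lemma cw_TP_row_limit:
  assumes "\<And>N. cw_TP r (\<lambda>i j. if i < N then M i j else 0)"
  shows "cw_TP r M"
  unfolding cw_TP_def
proof (intro allI impI)
  fix s and \<rho> \<gamma> :: "nat \<Rightarrow> nat"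
  assume *: "1 \<le> s \<and> s \<le> r \<and> strict_mono_on {..<s} \<rho> \<and> strict_mono_on {..<s} \<gamma>"
  obtain N where "\<rho> ` {..<s} \<subseteq> {..<N}" using finite_nat_bounded[of "\<rho> ` {..<s}"] by auto
  then have "minor M s \<rho> \<gamma> = minor (\<lambda>i j. if i < N then M i j else 0) s \<rho> \<gamma>"
    by (intro minor_reindex) auto
  then show "cw_nonneg (minor M s \<rho> \<gamma>)"
    using assms[of N] * by (simp add: cw_TP_def)
qed

text \<open>The index 0 contributes nothing and k -> k + 1 matches the other terms. The row indices
  are independent because in a direct sum 1 + M' they differ by one.\<close>

lemma imult_Suc_support:
  assumes "M i 0 = 0" "M' i' = (\<lambda>k. M i (Suc k))" "\<And>k. N' k j' = N (Suc k) j"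
    and "finite {k. M' i' k \<noteq> 0}"
  shows "imult M N i j = imult M' N' i' j'"
proof -
  have "imult M N i j = (\<Sum>k\<in>Suc ` {k. M' i' k \<noteq> 0}. M i k * N k j)"
  proof (rule imult_eq_sum)
    show "M i k = 0" if "k \<notin> Suc ` {k. M' i' k \<noteq> 0}" for k
      using that assms(1,2) by (cases k) auto
  qed (use assms in auto)
  also have "\<dots> = (\<Sum>k\<in>{k. M' i' k \<noteq> 0}. M' i' k * N' k j')"
    by (simp add: sum.reindex assms)
  also have "\<dots> = imult M' N' i' j'"
    by (rule imult_eq_sum[symmetric]) (use assms in auto)
  finally show ?thesis .
qed

lemma imult_row_unit:
  assumes "\<And>k. M i k = (if k = l then c else 0)"
  shows "imult M N i j = c * N l j"
  by (subst imult_eq_sum[where S = "{l}"]) (auto simp: assms)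

lemma row_finite_border:
  assumes "row_finite M"
  shows "row_finite (border M)"
  unfolding row_finite_def
proof
  show "finite {k. border M i k \<noteq> 0}" for i
    using assms by (cases i) (auto simp: row_finite_def border_def)
qed

lemma row_finite_shift_cols:
  assumes "row_finite M"
  shows "row_finite (shift_cols M)"
proof (rule row_finiteI[where S = "\<lambda>i. Suc ` {k. M i k \<noteq> 0}"])
  show "k \<notin> Suc ` {k. M i k \<noteq> 0} \<Longrightarrow> shift_cols M i k = 0" for i k
    by (cases k) (auto simp: shift_cols_def)
qed (use assms in \<open>auto simp: row_finite_def\<close>)

text \<open>The first \<open>N + 1\<close> rows of the output matrix \<open>R\<close> of \<open>P\<close> are the product of \<open>1 \<oplus> R\<^sub>N\<close>, where \<open>R\<^sub>N\<close>
  consists of the first \<open>N\<close> rows, and of \<open>P\<close> with the unit row \<open>e\<^sub>0\<close> put on top.\<close>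

theorem cw_TP_output_matrix:
  assumes R0: "\<And>k. R 0 k = (if k = 0 then 1 else 0)"
    and RS: "\<And>n k. R (Suc n) k = imult R P n k"
    and R: "row_finite R" and P: "cw_TP r P"
  shows "cw_TP r R"
proof (rule cw_TP_row_limit)
  fix N
  let ?R = "\<lambda>N i j. if i < N then R i j else 0"
  show "cw_TP r (?R N)"
  proof (induction N)
    case 0
    show ?case by (rule cw_TP_noncrossing) auto
  next
    case (Suc N)
    have fin: "row_finite (?R N)"
      using R by (auto simp: row_finite_def)
    have "?R (Suc N) = imult (border (shift_cols (?R N))) (border P)"
    proof (intro ext)
      fix i j
      show "?R (Suc N) i j = imult (border (shift_cols (?R N))) (border P) i j"
      proof (cases i)
        case 0
        then show ?thesis
          by (subst imult_row_unit[where l = 0 and c = 1]) (auto simp: border_def R0)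
      next
        case (Suc i')
        have "imult (border (shift_cols (?R N))) (border P) i j = imult (?R N) P i' j"
          by (rule imult_Suc_support)
            (use fin Suc in \<open>auto simp: border_def shift_cols_def row_finite_def\<close>)
        also have "\<dots> = ?R (Suc N) i j"
        proof (cases "i' < N")
          case True
          then have "imult (?R N) P i' j = imult R P i' j" by (simp add: imult_def)
          then show ?thesis using True Suc RS by simp
        qed (simp add: imult_def Suc)
        finally show ?thesis ..
      qed
    qed
    then show ?case
      by (simp add: Suc.IH P fin cw_TP_imult cw_TP_border cw_TP_shift_cols
          row_finite_border row_finite_shift_cols)
  qed
qed

text \<open>Mirror image of the preceding theorem: the first N + 1 columns are \<open>P\<close>,
  with e_0 put on its left, times the direct sum of 1 and the first N columns. Transposing that
  theorem would not do, as columns of \<open>P\<close> may have infinite support.\<close>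

lemma cw_TP_output_matrix_columns:
  assumes C0: "\<And>k. C k 0 = (if k = 0 then 1 else 0)"
    and CS: "\<And>k n. C k (Suc n) = imult P C k n"
    and Pf: "row_finite P" and P: "cw_TP r P"
  shows "cw_TP r C"
proof -
  let ?C = "\<lambda>N i j. if j < N then C i j else 0"
  \<comment> \<open>\<open>P\<close> with the extra left column e_0, got from \<open>border\<close>
    by transposing twice.\<close>
  let ?P = "\<lambda>i j. border (\<lambda>i j. P j i) j i"
  have TPP: "cw_TP r ?P"
    using cw_TP_transpose[OF cw_TP_border[OF cw_TP_transpose[OF P]]] .
  have finP: "row_finite ?P"
  proof (rule row_finiteI[where S = "\<lambda>i. insert 0 (Suc ` {k. P i k \<noteq> 0})"])
    show "k \<notin> insert 0 (Suc ` {k. P i k \<noteq> 0}) \<Longrightarrow> ?P i k = 0" for i k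
      by (cases k) (auto simp: border_def)
  qed (use Pf in \<open>auto simp: row_finite_def\<close>)
  have "cw_TP r (?C N)" for N
  proof (induction N)
    case 0
    show ?case by (rule cw_TP_noncrossing) auto
  next
    case (Suc N)
    have "?C (Suc N) = imult ?P (border (shift_cols (?C N)))"
    proof (intro ext)
      fix i j
      show "?C (Suc N) i j = imult ?P (border (shift_cols (?C N))) i j"
      proof (cases j)
        case 0
        have "imult ?P (border (shift_cols (?C N))) i j =
            (\<Sum>k\<in>insert 0 {k. ?P i k \<noteq> 0}. ?P i k * border (shift_cols (?C N)) k j)"
          by (rule imult_eq_sum) (use finP in \<open>auto simp: row_finite_def\<close>)
        also have "\<dots> = (\<Sum>k\<in>{0}. ?P i k * border (shift_cols (?C N)) k j)"
          by (rule sum.mono_neutral_right)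
            (use finP 0 in \<open>auto simp: row_finite_def border_def shift_cols_def split: nat.splits\<close>)
        finally show ?thesis using 0 by (simp add: border_def C0)
      next
        case (Suc j')
        have "imult ?P (border (shift_cols (?C N))) i j = imult P (?C N) i j'"
        proof -
          have "imult ?P (border (shift_cols (?C N))) i j =
              (\<Sum>k\<in>insert 0 (Suc ` {k. P i k \<noteq> 0}). ?P i k * border (shift_cols (?C N)) k j)"
          proof (rule imult_eq_sum)
            show "k \<notin> insert 0 (Suc ` {k. P i k \<noteq> 0}) \<Longrightarrow> ?P i k = 0" for k
              by (cases k) (auto simp: border_def)
          qed (use Pf in \<open>auto simp: row_finite_def\<close>)
          also have "\<dots> = (\<Sum>k\<in>{k. P i k \<noteq> 0}. P i k * ?C N k j')"
            using Pf by (subst sum.insert)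
              (auto simp: row_finite_def sum.reindex border_def shift_cols_def Suc intro!: sum.cong)
          finally show ?thesis by (simp add: imult_eq_support_sum[OF Pf])
        qed
        also have "\<dots> = ?C (Suc N) i j"
        proof (cases "j' < N")
          case True
          then show ?thesis using Suc CS by (simp add: imult_def)
        qed (simp add: imult_def Suc)
        finally show ?thesis ..
      qed
    qed
    then show ?case
      by (simp add: Suc.IH TPP finP cw_TP_imult cw_TP_border cw_TP_shift_cols)
  qed
  then have "cw_TP r (\<lambda>i j. ?C N j i)" for N by (rule cw_TP_transpose)
  then have "cw_TP r (\<lambda>i j. C j i)" by (rule cw_TP_row_limit)
  from cw_TP_transpose[OF this] show ?thesis .
qed

text \<open>Row n of \<open>R\<close> is row 0 of P^n, so R (n + n') 0 is the (0,0) entry of P^n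
  P^n'. Splitting between the two powers factors the Hankel matrix as \<open>R\<close> times the
  matrix \<open>C\<close> with columns P^n e_0.\<close>

theorem cw_Hankel_TP_output_matrix:
  assumes R0: "\<And>k. R 0 k = (if k = 0 then 1 else 0)"
    and RS: "\<And>n k. R (Suc n) k = imult R P n k"
    and R: "row_finite R" and Pf: "row_finite P" and P: "cw_TP r P"
  shows "cw_Hankel_TP r (\<lambda>n. R n 0)"
proof -
  \<comment> \<open>Column n is P^n e_0. The recursion is on single columns, whence the explicit
    finite sum instead of \<open>imult\<close>.\<close>
  define c where "c = rec_nat (\<lambda>k. if k = 0 then 1 else 0) (\<lambda>_ v k. \<Sum>l\<in>{l. P k l \<noteq> 0}. P k l * v l)"
  define C where "C = (\<lambda>k n. c n k)"
  have C0: "C k 0 = (if k = 0 then 1 else 0)" for k by (simp add: C_def c_def)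
  have CS: "C k (Suc n) = imult P C k n" for k n
    by (simp add: imult_eq_support_sum[OF Pf] C_def c_def)
  have RP: "(\<lambda>n. R (Suc n)) = imult R P" using RS by (intro ext) simp
  have PC: "(\<lambda>k n. C k (Suc n)) = imult P C" using CS by (intro ext) simp
  \<comment> \<open>One factor \<open>P\<close> at a time moves from \<open>R\<close> to
    \<open>C\<close> by (R P) C = R (P C); this raises \<open>n\<close>, which is therefore
    arbitrary.\<close>
  have "R (n + n') 0 = imult R C n n'" for n n'
  proof (induction n' arbitrary: n)
    case 0
    have "imult R C n 0 = imult R iid n 0"
      unfolding imult_def by (simp add: C0 iid_def)
    then show ?case by (simp add: imult_iid_right[OF R])
  next
    case (Suc n')
    have "R (n + Suc n') 0 = imult R C (Suc n) n'" using Suc.IH[of "Suc n"] by simp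
    also have "\<dots> = imult (\<lambda>n. R (Suc n)) C n n'" by (simp add: imult_def)
    also have "\<dots> = imult R (\<lambda>k n. C k (Suc n)) n n'"
      unfolding RP PC by (simp add: imult_assoc[OF R Pf])
    also have "\<dots> = imult R C n (Suc n')" by (simp add: imult_def)
    finally show ?case .
  qed
  then have "hankel (\<lambda>n. R n 0) = imult R C" by (intro ext) (simp add: hankel_def)
  then show ?thesis
    unfolding cw_Hankel_TP_def
    using cw_TP_imult[OF cw_TP_output_matrix[OF R0 RS R P]
        cw_TP_output_matrix_columns[where C = C, OF C0 CS Pf P] R] by simp
qed


section \<open>Conjugation by the binomial matrix\<close>

lemma imult_add_left:
  assumes "row_finite M" "row_finite N"
  shows "imult (\<lambda>i j. M i j + N i j) K = (\<lambda>i j. imult M K i j + imult N K i j)"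
proof (intro ext)
  fix i j
  let ?S = "{k. M i k \<noteq> 0} \<union> {k. N i k \<noteq> 0}"
  have S: "finite ?S" using assms by (auto simp: row_finite_def)
  have "imult (\<lambda>i j. M i j + N i j) K i j = (\<Sum>k\<in>?S. (M i k + N i k) * K k j)"
    "imult M K i j = (\<Sum>k\<in>?S. M i k * K k j)" "imult N K i j = (\<Sum>k\<in>?S. N i k * K k j)"
    by (rule imult_eq_sum[OF S]; simp)+
  then show "imult (\<lambda>i j. M i j + N i j) K i j = imult M K i j + imult N K i j"
    by (simp add: distrib_right sum.distrib)
qed

lemma imult_add_right:
  "row_finite K \<Longrightarrow> imult K (\<lambda>i j. M i j + N i j) = (\<lambda>i j. imult K M i j + imult K N i j)"
  by (intro ext) (simp add: imult_eq_support_sum distrib_left sum.distrib)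

lemma row_finite_scale: "row_finite M \<Longrightarrow> row_finite (\<lambda>i j. c * M i j)" for c :: "'a::comm_ring_1"
  unfolding row_finite_def by (metis (mono_tags, lifting) Collect_mono finite_subset mult_zero_right)

lemma row_finite_add: "row_finite M \<Longrightarrow> row_finite N \<Longrightarrow> row_finite (\<lambda>i j. M i j + N i j)"
  for M :: "'a::comm_ring_1 imat"
  by (rule row_finiteI[where S = "\<lambda>i. {k. M i k \<noteq> 0} \<union> {k. N i k \<noteq> 0}"]) (auto simp: row_finite_def)

lemma imult_scale_left:
  assumes "row_finite M"
  shows "imult (\<lambda>i j. c * M i j) K = (\<lambda>i j. c * imult M K i j)"
proof (intro ext)
  fix i j
  show "imult (\<lambda>i j. c * M i j) K i j = c * imult M K i j"
    using assms imult_eq_sum[where S = "{k. M i k \<noteq> 0}" and M = "\<lambda>i j. c * M i j" and i = i and N = K and j = j]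
    by (simp add: imult_eq_support_sum sum_distrib_left row_finite_def mult.assoc)
qed

lemma imult_scale_right:
  "row_finite K \<Longrightarrow> imult K (\<lambda>i j. c * M i j) = (\<lambda>i j. c * imult K M i j)"
  by (intro ext) (simp add: imult_eq_support_sum sum_distrib_left mult_ac)

lemma imult_col_unit:
  assumes "row_finite M" "\<And>k. N k j = (if k = l then c else 0)"
  shows "imult M N i j = M i l * c"
proof -
  have "imult M N i j = (\<Sum>k\<in>insert l {k. M i k \<noteq> 0}. M i k * N k j)"
    by (rule imult_eq_sum) (use assms in \<open>auto simp: row_finite_def\<close>)
  also have "\<dots> = (\<Sum>k\<in>{l}. M i k * N k j)"
    by (rule sum.mono_neutral_right) (use assms in \<open>auto simp: row_finite_def\<close>)
  finally show ?thesis by (simp add: assms)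
qed

text \<open>Expresses that \<open>M'\<close> is the conjugate of \<open>M\<close> by
  \<open>B\<close> without inverting \<open>B\<close>. Row-finiteness travels along because
  associativity needs it.\<close>

definition intertwines :: "'a::comm_ring_1 imat \<Rightarrow> 'a imat \<Rightarrow> 'a imat \<Rightarrow> bool" where
  "intertwines B M M' \<longleftrightarrow> row_finite M \<and> row_finite M' \<and> imult M B = imult B M'"

lemma intertwines_add:
  "row_finite B \<Longrightarrow> intertwines B M M' \<Longrightarrow> intertwines B N N' \<Longrightarrow>
    intertwines B (\<lambda>i j. M i j + N i j) (\<lambda>i j. M' i j + N' i j)"
  by (simp add: intertwines_def row_finite_add imult_add_left imult_add_right)

lemma intertwines_scale:
  "row_finite B \<Longrightarrow> intertwines B M M' \<Longrightarrow> intertwines B (\<lambda>i j. c * M i j) (\<lambda>i j. c * M' i j)"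
  by (simp add: intertwines_def row_finite_scale imult_scale_left imult_scale_right)

lemma intertwines_imult:
  assumes B: "row_finite B" and M: "intertwines B M M'" and N: "intertwines B N N'"
  shows "intertwines B (imult M N) (imult M' N')"
proof -
  have "imult (imult M N) B = imult M (imult B N')"
    using M N by (simp add: intertwines_def imult_assoc)
  also have "\<dots> = imult (imult M B) N'"
    using M imult_assoc[OF _ B, of M N'] by (simp add: intertwines_def)
  also have "\<dots> = imult B (imult M' N')"
    using M imult_assoc[OF B, of M' N'] by (simp add: intertwines_def)
  finally show ?thesis
    using M N by (simp add: intertwines_def row_finite_imult)
qed

lemma intertwines_iid: "row_finite B \<Longrightarrow> intertwines B iid iid"
  by (simp add: intertwines_def row_finite_iid imult_iid_left imult_iid_right)

text \<open>Read row \<open>n\<close> of a matrix as the image of \<open>x\<^sup>n\<close>: then \<open>raise_mat l\<close> is multiplication by \<open>x + l\<close>,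
  \<open>deriv_mat\<close> is differentiation and \<open>binom_mat q\<close> is the substitution of \<open>x + q\<close> for \<open>x\<close>.\<close>

definition raise_mat :: "'a::comm_ring_1 \<Rightarrow> 'a imat" where
  "raise_mat l = (\<lambda>i j. if j = Suc i then 1 else if j = i then l else 0)"

definition deriv_mat :: "'a::comm_ring_1 imat" where
  "deriv_mat = (\<lambda>i j. if i = Suc j then of_nat i else 0)"

lemma row_finite_raise_mat: "row_finite (raise_mat l)"
  by (rule row_finiteI[where S = "\<lambda>i. {i, Suc i}"]) (auto simp: raise_mat_def)

lemma row_finite_deriv_mat: "row_finite deriv_mat"
  by (rule row_finiteI[where S = "\<lambda>i. {i - 1}"]) (auto simp: deriv_mat_def)

lemma row_finite_binom_mat: "row_finite (binom_mat q)"
  by (rule row_finiteI[where S = "\<lambda>i. {..i}"]) (auto simp: binom_mat_def binomial_eq_0)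

lemma imult_raise_mat: "imult (raise_mat l) M i j = M (Suc i) j + l * M i j"
  by (subst imult_eq_sum[where S = "{i, Suc i}"]) (auto simp: raise_mat_def)

lemma imult_deriv_mat: "imult deriv_mat M i j = of_nat i * M (i - 1) j"
  by (subst imult_eq_sum[where S = "{i - 1}"]) (auto simp: deriv_mat_def, cases i, auto)

lemma imult_raise_mat_right:
  assumes "row_finite M"
  shows "imult M (raise_mat l) i j = (if j = 0 then 0 else M i (j - 1)) + l * M i j"
proof -
  have "raise_mat l = (\<lambda>i j. (if j = Suc i then 1 else 0) + l * iid i j)"
    by (intro ext) (auto simp: raise_mat_def iid_def)
  moreover have "imult M (\<lambda>i j. if j = Suc i then 1 else 0) i j = M i (j - 1) * (if j = 0 then 0 else 1)"
    by (rule imult_col_unit[OF assms]) auto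
  ultimately show ?thesis
    by (simp add: imult_add_right imult_scale_right imult_iid_right assms)
qed

text \<open>Substituting x + q for x turns the factor x + l into x + l + q. In entries this is
  Pascal's rule.\<close>

lemma intertwines_raise_mat: "intertwines (binom_mat q) (raise_mat l) (raise_mat (l + q))"
proof -
  have pascal: "binom_mat q (Suc i) j =
      (if j = 0 then 0 else binom_mat q i (j - 1)) + q * binom_mat q i j" for i j
  proof (cases j)
    case (Suc j')
    show ?thesis
    proof (cases "j' < i")
      case True
      then have "i - j' = Suc (i - Suc j')" by simp
      with Suc show ?thesis by (simp add: binom_mat_def algebra_simps)
    qed (simp add: Suc binom_mat_def binomial_eq_0)
  qed (simp add: binom_mat_def)
  have "imult (raise_mat l) (binom_mat q) = imult (binom_mat q) (raise_mat (l + q))"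
    by (intro ext) (simp add: imult_raise_mat imult_raise_mat_right row_finite_binom_mat pascal algebra_simps)
  then show ?thesis by (simp add: intertwines_def row_finite_raise_mat)
qed

text \<open>Differentiation commutes with translation; in entries, i C(i-1,j) = (j+1)
  C(i,j+1).\<close>

lemma intertwines_deriv_mat: "intertwines (binom_mat q) deriv_mat deriv_mat"
proof -
  have "imult deriv_mat (binom_mat q) i j = imult (binom_mat q) deriv_mat i j" for i j
  proof -
    have "imult (binom_mat q) deriv_mat i j = binom_mat q i (Suc j) * of_nat (Suc j)"
      by (rule imult_col_unit[OF row_finite_binom_mat]) (auto simp: deriv_mat_def)
    moreover have "of_nat i * binom_mat q (i - 1) j = binom_mat q i (Suc j) * of_nat (Suc j)"
    proof (cases i)
      case (Suc i')
      have "(of_nat (Suc i' * (i' choose j)) :: 'a) = of_nat ((Suc i' choose Suc j) * Suc j)"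
        by (simp only: Suc_times_binomial_eq)
      then have "of_nat (Suc i') * of_nat (i' choose j) = (of_nat (Suc i' choose Suc j) * of_nat (Suc j) :: 'a)"
        by (simp only: of_nat_mult)
      with Suc show ?thesis
        unfolding binom_mat_def by (simp only: diff_Suc_1 diff_Suc_Suc) (metis mult.assoc mult.commute)
    qed (simp add: binom_mat_def)
    ultimately show ?thesis by (simp add: imult_deriv_mat)
  qed
  then show ?thesis by (auto simp: intertwines_def row_finite_deriv_mat)
qed

text \<open>With D = d/dx this is the operator u (x+l) D (x+l) + v (x+l) + a (x+l) D + b. As
  \<open>l\<close> enters only through x + l, translation by \<open>q\<close> replaces it by l +
  q.\<close>

lemma Jmat_eq:
  "Jmat a b u v l = (\<lambda>i j. u * imult (raise_mat l) (imult deriv_mat (raise_mat l)) i j +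
     (v * raise_mat l i j + (a * imult deriv_mat (raise_mat l) i j + b * iid i j)))"
  unfolding imult_raise_mat imult_deriv_mat
  by (intro ext) (auto simp: Jmat_def raise_mat_def iid_def algebra_simps)

text \<open>The operator a (x+q) D + b + c D. Writing the last parameter as c + a q lets one formula
  describe both sides of the conjugation, the left one with q = 0.\<close>

lemma Lmat_eq:
  "Lmat a b (c + a * q) = (\<lambda>i j. a * imult deriv_mat (raise_mat q) i j + (b * iid i j + c * deriv_mat i j))"
proof (intro ext)
  show "Lmat a b (c + a * q) i j =
      a * imult deriv_mat (raise_mat q) i j + (b * iid i j + c * deriv_mat i j)" for i j
    unfolding imult_deriv_mat
    by (cases i) (auto simp: Lmat_def raise_mat_def deriv_mat_def iid_def algebra_simps)
qed

lemma intertwines_Jmat: "intertwines (binom_mat q) (Jmat a b u v l) (Jmat a b u v (l + q))"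
  unfolding Jmat_eq
  by (intro intertwines_add intertwines_scale intertwines_imult intertwines_iid
      intertwines_raise_mat intertwines_deriv_mat row_finite_binom_mat)

lemma intertwines_Lmat: "intertwines (binom_mat q) (Lmat a b c) (Lmat a b (c + a * q))"
proof -
  have "intertwines (binom_mat q) (Lmat a b (c + a * 0)) (Lmat a b (c + a * (0 + q)))"
    unfolding Lmat_eq
    by (intro intertwines_add intertwines_scale intertwines_imult intertwines_iid
        intertwines_raise_mat intertwines_deriv_mat row_finite_binom_mat)
  then show ?thesis by simp
qed

lemma Const_mult: "Const c * Const d = Const (c * d)"
  by (simp add: Const_def mult_single)

lemma of_nat_eq_Const: "of_nat n = Const (real n)"
  by (simp add: Const_def)

lemma row_finite_Gamma_Lam: "row_finite (Gamma_Lam f)"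
  by (rule row_finiteI[where S = "\<lambda>i. {..i}"]) (auto simp: Gamma_Lam_def toeplitz_def)

text \<open>The matrix is the operator f(D), which commutes with translation. Since \<open>f\<close>
  may have infinitely many terms, the entries are compared directly.\<close>

lemma intertwines_Gamma_Lam: "intertwines (binom_mat q) (Gamma_Lam f) (Gamma_Lam f)"
proof -
  have "imult (Gamma_Lam f) (binom_mat q) i j = imult (binom_mat q) (Gamma_Lam f) i j" for i j
  proof -
    have "imult (Gamma_Lam f) (binom_mat q) i j = (\<Sum>k\<le>i. Gamma_Lam f i k * binom_mat q k j)"
      by (rule imult_eq_sum) (auto simp: Gamma_Lam_def toeplitz_def)
    also have "\<dots> = (\<Sum>k\<in>{j..i}. Gamma_Lam f i k * binom_mat q k j)"
      by (rule sum.mono_neutral_right) (auto simp: binom_mat_def binomial_eq_0)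
    also have "\<dots> = (\<Sum>k\<in>{j..i}. binom_mat q i k * Gamma_Lam f k j)"
    \<comment> \<open>Reflecting {j..i} matches the terms: both contain f_(i-k) q^(k-j) with
      coefficient i! / (j! (k-j)!). The factorials cancel over the reals and enter the ring through
      \<open>Const\<close>.\<close>
    proof (rule sum.reindex_bij_witness[where i = "\<lambda>k. i + j - k" and j = "\<lambda>k. i + j - k"])
      fix k assume k: "k \<in> {j..i}"
      have "i + j - k \<le> i" "i - (i + j - k) = k - j" using k by auto
      then have "real (i choose (i + j - k)) = fact i / (fact (i + j - k) * fact (k - j))"
        by (simp add: binomial_fact)
      then have "real (i choose (i + j - k)) * (fact (i + j - k) / fact j) =
          fact i / fact k * real (k choose j)"
        using k by (simp add: binomial_fact)
      then have c: "Const (real (i choose (i + j - k))) * Const (fact (i + j - k) / fact j) =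
          Const (fact i / fact k) * Const (real (k choose j))"
        by (simp only: Const_mult)
      have sub: "i - (i + j - k) = k - j" "i + j - k - j = i - k" "j \<le> i + j - k" using k by auto
      have "binom_mat q i (i + j - k) * Gamma_Lam f (i + j - k) j =
          (Const (real (i choose (i + j - k))) * Const (fact (i + j - k) / fact j)) *
          (fps_nth f (i - k) * q ^ (k - j))"
        by (simp add: binom_mat_def Gamma_Lam_def toeplitz_def of_nat_eq_Const sub mult_ac)
      also have "\<dots> = Gamma_Lam f i k * binom_mat q k j"
        unfolding c using k
        by (simp add: binom_mat_def Gamma_Lam_def toeplitz_def of_nat_eq_Const mult_ac)
      finally show "binom_mat q i (i + j - k) * Gamma_Lam f (i + j - k) j =
          Gamma_Lam f i k * binom_mat q k j" .
    qed auto
    also have "\<dots> = (\<Sum>k\<le>i. binom_mat q i k * Gamma_Lam f k j)"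
      by (rule sum.mono_neutral_left) (auto simp: Gamma_Lam_def toeplitz_def)
    also have "\<dots> = imult (binom_mat q) (Gamma_Lam f) i j"
      by (rule imult_eq_sum[symmetric]) (auto simp: binom_mat_def binomial_eq_0)
    finally show ?thesis .
  qed
  then show ?thesis by (auto simp: intertwines_def row_finite_Gamma_Lam)
qed

section \<open>Total positivity of the factors\<close>

lemma minor_scale:
  "minor (\<lambda>i j. c i * d j * M i j) s \<rho> \<gamma> = (\<Prod>i<s. c (\<rho> i)) * (\<Prod>j<s. d (\<gamma> j)) * minor M s \<rho> \<gamma>"
proof -
  have "(\<Prod>i<s. c (\<rho> i) * d (\<gamma> (p i)) * M (\<rho> i) (\<gamma> (p i))) =
      (\<Prod>i<s. c (\<rho> i)) * (\<Prod>j<s. d (\<gamma> j)) * (\<Prod>i<s. M (\<rho> i) (\<gamma> (p i)))"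
    if "p permutes {..<s}" for p
    using prod.permute[OF that, of "\<lambda>j. d (\<gamma> j)"] by (simp add: prod.distrib o_def)
  then show ?thesis
    unfolding minor_leibniz sum_distrib_left by (intro sum.cong) (auto simp: mult_ac)
qed

text \<open>Scaling rows and columns by positive constants multiplies each minor by a positive
  constant.\<close>

lemma cw_TP_Gamma_Lam:
  assumes "cw_TP r (toeplitz f)"
  shows "cw_TP r (Gamma_Lam f)"
proof -
  have "Gamma_Lam f = (\<lambda>i j. Const (fact i) * Const (1 / fact j) * toeplitz f i j)"
    by (simp add: Gamma_Lam_def Const_mult)
  then have "minor (Gamma_Lam f) s \<rho> \<gamma> =
      (\<Prod>i<s. Const (fact (\<rho> i))) * (\<Prod>j<s. Const (1 / fact (\<gamma> j))) * minor (toeplitz f) s \<rho> \<gamma>" for s \<rho> \<gamma>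
    by (simp only: minor_scale)
  then show ?thesis
    using assms unfolding cw_TP_def
    by (auto intro!: cw_nonneg_mult cw_nonneg_prod cw_nonneg_Const)
qed

text \<open>Crossing nonzero entries would need j' \<le> i < i' \<le> j + 1 \<le> j'.\<close>

lemma cw_TP_Lmat:
  assumes "cw_nonneg a" "cw_nonneg b" "cw_nonneg c"
  shows "cw_TP r (Lmat a b c)"
  by (rule cw_TP_noncrossing)
    (use assms in \<open>auto simp: Lmat_def intro!: cw_nonneg_add cw_nonneg_mult\<close>)

text \<open>\<open>V W\<close> comes from the bidiagonal factorization of \<open>J(a,0,u,v,\<lambda>)\<close>, read as a planar network: every level \<open>n\<close> gets an additional middle
  vertex \<open>2n + 1\<close> carrying an edge of weight \<open>b\<close> from \<open>n\<close> to \<open>n\<close>.\<close>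

lemma cw_TP_Jmat:
  assumes "cw_nonneg a" "cw_nonneg b" "cw_nonneg u" "cw_nonneg v" "cw_nonneg l"
  shows "cw_TP r (Jmat a b u v l)"
proof -
  define V where "V = (\<lambda>i j. if j = 2 * i then (a + l * u) * of_nat i else if j = Suc (2 * i) then b
    else if j = Suc (Suc (2 * i)) then u * of_nat i + u + v else 0)"
  define W where "W = (\<lambda>k j. if k = 2 * j \<or> k = Suc (2 * j) then 1
    else if k = Suc (Suc (2 * j)) then l else 0)"
  \<comment> \<open>Row i of \<open>V\<close> lives in columns 2i to 2i+2, so successive rows share
    only one column and nothing crosses; likewise for the columns of \<open>W\<close>.\<close>
  have "cw_TP r V"
    by (rule cw_TP_noncrossing)
      (use assms in \<open>auto simp: V_def intro!: cw_nonneg_add cw_nonneg_mult\<close>)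
  moreover have "cw_TP r W"
    by (rule cw_TP_noncrossing) (use assms in \<open>auto simp: W_def\<close>)
  moreover have "row_finite V"
    by (rule row_finiteI[where S = "\<lambda>i. {2 * i, Suc (2 * i), Suc (Suc (2 * i))}"]) (auto simp: V_def)
  moreover have "Jmat a b u v l = imult V W"
  proof (intro ext)
    fix i j
    have "imult V W i j = (\<Sum>k\<in>{2 * i, Suc (2 * i), Suc (Suc (2 * i))}. V i k * W k j)"
      by (rule imult_eq_sum) (auto simp: V_def)
    also have "\<dots> = V i (2 * i) * W (2 * i) j + V i (Suc (2 * i)) * W (Suc (2 * i)) j
        + V i (Suc (Suc (2 * i))) * W (Suc (Suc (2 * i))) j"
      by (simp add: add.assoc)
    also have "\<dots> = Jmat a b u v l i j"
    proof -
      have parity: "2 * i \<noteq> Suc (2 * j)" "Suc (2 * i) \<noteq> 2 * j" "2 * i = Suc (Suc (2 * j)) \<longleftrightarrow> i = Suc j"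
        "Suc (Suc (2 * i)) = 2 * j \<longleftrightarrow> j = Suc i"
        by presburger+
      show ?thesis
        by (auto simp: V_def W_def Jmat_def parity algebra_simps)
    qed
    finally show "Jmat a b u v l i j = imult V W i j" ..
  qed
  ultimately show ?thesis by (simp add: cw_TP_imult)
qed


section \<open>The Jacobi-Rogers triangle\<close>

text \<open>Each step rises by at most one. The bound makes the path sets finite even for m =
  \<infinity>, and the triangle row-finite.\<close>

lemma luka_path_height_le:
  assumes "hs \<in> luka_paths m n k" "i \<le> n"
  shows "hs ! i \<le> i"
  using assms(2)
proof (induction i)
  case (Suc i)
  then have "luka_step m (hs ! i) (hs ! Suc i)" using assms(1) by (simp add: luka_paths_def)
  with Suc show ?case by (simp add: luka_step_def)
qed (use assms in \<open>simp add: luka_paths_def\<close>)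

lemma finite_luka_paths: "finite (luka_paths m n k)"
proof (rule finite_subset)
  show "luka_paths m n k \<subseteq> {hs. set hs \<subseteq> {..n} \<and> length hs = Suc n}"
  proof
    fix hs assume hs: "hs \<in> luka_paths m n k"
    then have len: "length hs = Suc n" by (simp add: luka_paths_def)
    have "x \<le> n" if x: "x \<in> set hs" for x
    proof -
      obtain i where "i < Suc n" "x = hs ! i" using x len by (metis in_set_conv_nth)
      then show ?thesis using luka_path_height_le[OF hs, of i] by simp
    qed
    then show "hs \<in> {hs. set hs \<subseteq> {..n} \<and> length hs = Suc n}" using len by auto
  qed
qed (simp add: finite_lists_length_eq)

lemma luka_paths_empty: "n < k \<Longrightarrow> luka_paths m n k = {}"
  using luka_path_height_le[where m = m and n = n and k = k and i = n]
  by (fastforce simp: luka_paths_def)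

lemma row_finite_jacobi_rogers: "row_finite (jacobi_rogers m \<beta>)"
  by (rule row_finiteI[where S = "\<lambda>n. {..n}"]) (auto simp: jacobi_rogers_def luka_paths_empty)

lemma jacobi_rogers_0: "jacobi_rogers m \<beta> 0 k = (if k = 0 then 1 else 0)"
proof -
  have "luka_paths m 0 k = (if k = 0 then {[0]} else {})"
    by (auto simp: luka_paths_def length_Suc_conv)
  then show ?thesis by (simp add: jacobi_rogers_def)
qed

lemma luka_P_eq_step_weight: "luka_P m \<beta> h h' = (if luka_step m h h' then step_weight m \<beta> h h' else 0)"
  by (auto simp: luka_P_def luka_step_def step_weight_def zero_enat_def[symmetric])

text \<open>Delete the last step of a path and sort by the height \<open>j\<close> from which it
  starts.\<close>

lemma jacobi_rogers_Suc:
  "jacobi_rogers m \<beta> (Suc n) k = imult (jacobi_rogers m \<beta>) (luka_P m \<beta>) n k"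
proof -
  let ?w = "\<lambda>n hs. \<Prod>i<n. step_weight m \<beta> (hs ! i) (hs ! Suc i)"
  \<comment> \<open>The bound j \<le> n keeps the set finite: for m = \<infinity> a step to
    \<open>k\<close> may start at arbitrarily large heights.\<close>
  let ?J = "{j. j \<le> n \<and> luka_step m j k}"
  have app: "(hs @ [k]) ! i = hs ! i" "(hs @ [k]) ! Suc n = k"
    if "hs \<in> luka_paths m n j" "i \<le> n" for hs i j
    using that by (auto simp: luka_paths_def nth_append)
  have "jacobi_rogers m \<beta> (Suc n) k =
      (\<Sum>(j, hs)\<in>(SIGMA j:?J. luka_paths m n j). ?w n hs * step_weight m \<beta> j k)"
    unfolding jacobi_rogers_def
  proof (rule sum.reindex_bij_witness[where i = "\<lambda>(j, hs). hs @ [k]" and j = "\<lambda>hs. (hs ! n, butlast hs)"])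
    fix hs assume hs: "hs \<in> luka_paths m (Suc n) k"
    then have len: "length hs = Suc (Suc n)" and last: "hs ! Suc n = k" and hs0: "hs ! 0 = 0"
      and step: "\<And>i. i < Suc n \<Longrightarrow> luka_step m (hs ! i) (hs ! Suc i)"
      by (auto simp: luka_paths_def)
    have bl: "butlast hs ! i = hs ! i" if "i \<le> n" for i
      using that len by (simp add: nth_butlast)
    have "hs = butlast hs @ [hs ! Suc n]"
      using len by (metis append_butlast_last_id diff_Suc_1 last_conv_nth length_0_conv nat.distinct(1))
    then show "(case (hs ! n, butlast hs) of (j, hs) \<Rightarrow> hs @ [k]) = hs"
      using last by simp
    have "butlast hs \<in> luka_paths m n (hs ! n)"
      using len hs0 step bl by (auto simp: luka_paths_def)
    moreover have "hs ! n \<le> n" by (rule luka_path_height_le[OF hs]) simp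
    moreover have "luka_step m (hs ! n) k" using step[of n] last by simp
    ultimately show "(hs ! n, butlast hs) \<in> (SIGMA j:?J. luka_paths m n j)" by simp
    show "(case (hs ! n, butlast hs) of (j, hs) \<Rightarrow> ?w n hs * step_weight m \<beta> j k) = ?w (Suc n) hs"
      using last bl by simp
  next
    fix x assume "x \<in> (SIGMA j:?J. luka_paths m n j)"
    then obtain j hs where x: "x = (j, hs)" "j \<le> n" "luka_step m j k" "hs \<in> luka_paths m n j"
      by auto
    note app = app[OF x(4)]
    have hs: "length hs = Suc n" "hs ! 0 = 0" "hs ! n = j"
      "\<And>i. i < n \<Longrightarrow> luka_step m (hs ! i) (hs ! Suc i)"
      using x(4) by (auto simp: luka_paths_def)
    have "luka_step m ((hs @ [k]) ! i) ((hs @ [k]) ! Suc i)" if "i < Suc n" for i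
      using that app(1)[of i] app(1)[of "Suc i"] app(2)[of n] hs x(3) by (cases "i = n") auto
    then show "(case x of (j, hs) \<Rightarrow> hs @ [k]) \<in> luka_paths m (Suc n) k"
      using hs app(1)[of 0] app(2)[of n] by (simp add: x luka_paths_def)
    show "((case x of (j, hs) \<Rightarrow> hs @ [k]) ! n, butlast (case x of (j, hs) \<Rightarrow> hs @ [k])) = x"
      using app hs by (simp add: x)
  qed
  also have "\<dots> = (\<Sum>j\<in>?J. \<Sum>hs\<in>luka_paths m n j. ?w n hs * step_weight m \<beta> j k)"
    by (rule sum.Sigma[symmetric]) (auto simp: finite_luka_paths)
  also have "\<dots> = (\<Sum>j\<in>?J. jacobi_rogers m \<beta> n j * luka_P m \<beta> j k)"
    by (simp add: jacobi_rogers_def sum_distrib_right luka_P_eq_step_weight)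
  also have "\<dots> = (\<Sum>j\<le>n. jacobi_rogers m \<beta> n j * luka_P m \<beta> j k)"
    by (rule sum.mono_neutral_left) (auto simp: luka_P_eq_step_weight)
  also have "\<dots> = imult (jacobi_rogers m \<beta>) (luka_P m \<beta>) n k"
    by (rule imult_eq_sum[symmetric]) (auto simp: jacobi_rogers_def luka_paths_empty)
  finally show ?thesis .
qed

section \<open>Assembly: conjugating the production matrix\<close>

lemma iprod_intertwines_cw_TP:
  assumes "row_finite B" "\<And>M. M \<in> set Ms \<Longrightarrow> \<exists>M'. intertwines B M M' \<and> cw_TP r M'"
  shows "\<exists>P'. intertwines B (iprod Ms) P' \<and> cw_TP r P'"
  using assms(2)
proof (induction Ms)
  case Nil
  have "cw_TP r iid" by (rule cw_TP_noncrossing) (auto simp: iid_def)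
  then show ?case using intertwines_iid[OF assms(1)] by (auto simp: iprod_def)
next
  case (Cons M Ms)
  then obtain M' P' where "intertwines B M M'" "cw_TP r M'" "intertwines B (iprod Ms) P'" "cw_TP r P'"
    by (metis list.set_intros)
  then have "intertwines B (imult M (iprod Ms)) (imult M' P')" "cw_TP r (imult M' P')"
    by (auto simp: intertwines_imult assms(1) cw_TP_imult intertwines_def[of B M])
  then show ?case by (auto simp: iprod_def)
qed

theorem theorem1p7:
  fixes m :: enat and r :: nat
    and \<beta> :: "int \<Rightarrow> nat \<Rightarrow> 'x indet mpol"
    and \<sigma> :: "param \<Rightarrow> 'x indet mpol"
    and f :: "nat \<Rightarrow> 'x indet mpol fps"
    and As Bs :: "'x indet mpol imat list"
  assumes "1 \<le> m" and "1 \<le> r"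
    and "specialization \<sigma>"
    and "\<And>i. 1 \<le> i \<Longrightarrow> x_Polya_frequency r (f i)"
    and "\<And>M. M \<in> set As \<union> set Bs \<Longrightarrow>
           \<exists>i\<ge>1. M = Lmat (\<sigma> (PAhat i)) (\<sigma> (PBhat i)) (\<sigma> (PChat i)) \<or> M = Gamma_Lam (f i)"
    and "luka_P m \<beta> =
           iprod (As @ [Jmat (\<sigma> PA) (\<sigma> PB) (\<sigma> PU) (\<sigma> PV) (\<sigma> PLam)] @ Bs)"
  shows "cw_TP r (binom_row_gen_mat (jacobi_rogers m \<beta>) (Var Q)) \<and>
         cw_Hankel_TP r (row_gen (jacobi_rogers m \<beta>) (Var Q))"
proof -
  let ?B = "binom_mat (Var Q :: 'x indet mpol)"
  let ?O = "jacobi_rogers m \<beta>"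
  have B: "row_finite ?B" by (rule row_finite_binom_mat)
  have \<sigma>: "cw_nonneg (\<sigma> p)" for p using assms(3) by (simp add: specialization_def)
  \<comment> \<open>The parameters l + q and c + a q of the conjugates remain coefficientwise
    nonnegative.\<close>
  have "\<exists>M'. intertwines ?B M M' \<and> cw_TP r M'"
    if M: "M \<in> set (As @ [Jmat (\<sigma> PA) (\<sigma> PB) (\<sigma> PU) (\<sigma> PV) (\<sigma> PLam)] @ Bs)" for M
  proof -
    consider "M = Jmat (\<sigma> PA) (\<sigma> PB) (\<sigma> PU) (\<sigma> PV) (\<sigma> PLam)"
      | i where "i \<ge> 1" "M = Lmat (\<sigma> (PAhat i)) (\<sigma> (PBhat i)) (\<sigma> (PChat i))"
      | i where "i \<ge> 1" "M = Gamma_Lam (f i)"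
      using M assms(5)[of M] by auto
    then show ?thesis
    proof cases
      case 1
      then show ?thesis
        using intertwines_Jmat cw_TP_Jmat \<sigma> by (metis cw_nonneg_Var cw_nonneg_add)
    next
      case 2
      then show ?thesis
        using intertwines_Lmat cw_TP_Lmat \<sigma> by (metis cw_nonneg_Var cw_nonneg_add cw_nonneg_mult)
    next
      case 3
      then show ?thesis
        using intertwines_Gamma_Lam cw_TP_Gamma_Lam assms(4) by (metis x_Polya_frequency_def)
    qed
  qed
  then obtain P' where "intertwines ?B (luka_P m \<beta>) P'" and P': "cw_TP r P'"
    using iprod_intertwines_cw_TP[OF B] unfolding assms(6) by metis
  then have P'f: "row_finite P'" and Pf: "row_finite (luka_P m \<beta>)"
    and PB: "imult (luka_P m \<beta>) ?B = imult ?B P'"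
    by (auto simp: intertwines_def)
  define R where "R = binom_row_gen_mat ?O (Var Q)"
  have R: "R = imult ?O ?B" by (simp add: R_def binom_row_gen_mat_def)
  have Rf: "row_finite R" unfolding R by (rule row_finite_imult[OF row_finite_jacobi_rogers B])
  have R0: "R 0 k = (if k = 0 then 1 else 0)" for k
    unfolding R by (subst imult_row_unit[where l = 0 and c = 1]) (auto simp: jacobi_rogers_0 binom_mat_def)
  \<comment> \<open>With O the triangle and P its production matrix, (O P) B = O (B P') = (O B) P',
    so \<open>R\<close> is the output matrix of \<open>P'\<close>.\<close>
  have RS: "R (Suc n) k = imult R P' n k" for n k
  proof -
    have "R (Suc n) k = imult (imult ?O (luka_P m \<beta>)) ?B n k"
      unfolding R by (simp add: imult_def[of _ ?B] jacobi_rogers_Suc)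
    then show ?thesis
      unfolding R by (simp add: imult_assoc row_finite_jacobi_rogers Pf B PB)
  qed
  \<comment> \<open>Column 0 of the binomial matrix consists of the powers of
    \<open>q\<close>.\<close>
  have "row_gen ?O (Var Q) = (\<lambda>n. R n 0)"
    by (intro ext) (simp add: row_gen_def R imult_def binom_mat_def)
  then show ?thesis
    using cw_TP_output_matrix[OF R0 RS Rf P'] cw_Hankel_TP_output_matrix[OF R0 RS Rf P'f P']
    by (simp add: R_def)
qed

end
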